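(* Let $K$ be a pathwise connected poset and $G$ a group. For every principal net $G$-bundle $\mathcal{P}=(P,p,J,R,K)$, the fibre bundle $p:\tau P\to\tau K$ is locally constant.
   Context: Net bundle over $K$: $(P,p,J,K)$ with $p:P\to K$ surjective, fibres $P_a=p^{-1}(a)$, and bijections $J_{(a',a)}:P_a\to P_{a'}$ for $a\leq a'$ in $K$ with $J_{(a,a)}=\mathrm{id}$ and $J_{(a'',a')}J_{(a',a)}=J_{(a'',a)}$. A principal net $G$-bundle is a net bundle with a right action $R$ of $G$ on $P$ which preserves the fibres, is free and transitive on each fibre, and commutes with the net structure: $J_{(a',a)}(R_g x)=R_g(J_{(a',a)}x)$. $G$ is a topological group (with the discrete topology if no topology is given), and each fibre $P_a$ has the topology transported from $G$ by an orbit map $g\mapsto R_gx$, $x\in P_a$ (independent of $x$), so the $J_{(a',a)}$ are homeomorphisms. $\tau K$ is $K$ with the Alexandroff topology, with base $V_a=\{o\in K:a\leq o\}$. $\tau P$ is $P$ with the topology having as base the cylinders $T_{a,U}=\bigcup_{o\in V_a}J_{(o,a)}(U)$, $a\in K$, $U\subseteq P_a$ open. $p:\tau P\to\tau K$ is a locally trivial bundle with fibre $G$. A locally trivial bundle is locally constant if it has a set of local trivializations whose transition maps are locally constant, i.e. constant on the connected components of their domains. $K$ is pathwise connected if any two elements are joined by a finite chain of elements of $K$ in which consecutive elements are comparable. *)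

theory Defs
  imports "HOL-Analysis.Analysis" "HOL-Algebra.Group"
begin

section \<open>Topological groups\<close>

text \<open>No separation axiom is imposed on the topology.\<close>

locale topological_group = group G for G (structure) +
  fixes TG :: "'g topology"
  assumes topspace_eq: "topspace TG = carrier G"
    and continuous_mult: "continuous_map (prod_topology TG TG) TG (\<lambda>(g, h). g \<otimes> h)"
    and continuous_inv: "continuous_map TG TG (\<lambda>g. inv g)"

text \<open>A group without a specified topology is a topological group with the discrete one.\<close>

lemma (in group) topological_group_discrete:
  "topological_group G (discrete_topology (carrier G))"
  by unfold_locales
    (auto simp flip: prod_topology_discrete_topology)


section \<open>Posets\<close>

definition pathwise_connected_poset :: "('k, 'm) gorder_scheme \<Rightarrow> bool" where
  "pathwise_connected_poset K \<longleftrightarrow>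
     (\<forall>a \<in> carrier K. \<forall>b \<in> carrier K.
        (a, b) \<in> {(x, y). x \<in> carrier K \<and> y \<in> carrier K \<and> (x \<sqsubseteq>\<^bsub>K\<^esub> y \<or> y \<sqsubseteq>\<^bsub>K\<^esub> x)}\<^sup>*)"

definition up_set :: "('k, 'm) gorder_scheme \<Rightarrow> 'k \<Rightarrow> 'k set" where
  "up_set K a = {o' \<in> carrier K. a \<sqsubseteq>\<^bsub>K\<^esub> o'}"

definition alexandroff_topology :: "('k, 'm) gorder_scheme \<Rightarrow> 'k topology" where
  "alexandroff_topology K = topology (arbitrary union_of (\<lambda>S. \<exists>a \<in> carrier K. S = up_set K a))"


section \<open>Net bundles\<close>

definition fibre :: "'p set \<Rightarrow> ('p \<Rightarrow> 'k) \<Rightarrow> 'k \<Rightarrow> 'p set" where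
  "fibre P p a = {x \<in> P. p x = a}"

text \<open>\<open>J a' a\<close> is the bijection from the fibre over \<open>a\<close> to the fibre over \<open>a'\<close>; its values are
  only relevant for \<open>a \<sqsubseteq> a'\<close> in \<open>K\<close> and for arguments in the fibre over \<open>a\<close>.\<close>

locale net_bundle = partial_order K for K :: "('k, 'm) gorder_scheme" (structure) +
  fixes P :: "'p set" and p :: "'p \<Rightarrow> 'k" and J :: "'k \<Rightarrow> 'k \<Rightarrow> 'p \<Rightarrow> 'p"
  assumes surj: "p ` P = carrier K"
    and J_bij: "\<lbrakk>a \<in> carrier K; a' \<in> carrier K; a \<sqsubseteq> a'\<rbrakk>
        \<Longrightarrow> bij_betw (J a' a) (fibre P p a) (fibre P p a')"
    and J_id: "\<lbrakk>a \<in> carrier K; x \<in> fibre P p a\<rbrakk> \<Longrightarrow> J a a x = x"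
    and J_comp: "\<lbrakk>a \<in> carrier K; a' \<in> carrier K; a'' \<in> carrier K; a \<sqsubseteq> a'; a' \<sqsubseteq> a'';
        x \<in> fibre P p a\<rbrakk> \<Longrightarrow> J a'' a' (J a' a x) = J a'' a x"

locale principal_net_bundle =
  net_bundle K P p J + topological_group G TG
  for K :: "('k, 'm) gorder_scheme" and P :: "'p set" and p J
    and G :: "('g, 'n) monoid_scheme" and TG +
  fixes R :: "'g \<Rightarrow> 'p \<Rightarrow> 'p"
  assumes R_fibre: "\<lbrakk>g \<in> carrier G; a \<in> carrier K; x \<in> fibre P p a\<rbrakk> \<Longrightarrow> R g x \<in> fibre P p a"
    and R_one: "x \<in> P \<Longrightarrow> R \<one>\<^bsub>G\<^esub> x = x"
    and R_mult: "\<lbrakk>g \<in> carrier G; h \<in> carrier G; x \<in> P\<rbrakk> \<Longrightarrow> R (g \<otimes>\<^bsub>G\<^esub> h) x = R h (R g x)"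
    and R_free: "\<lbrakk>g \<in> carrier G; x \<in> P; R g x = x\<rbrakk> \<Longrightarrow> g = \<one>\<^bsub>G\<^esub>"
    and R_transitive: "\<lbrakk>a \<in> carrier K; x \<in> fibre P p a; y \<in> fibre P p a\<rbrakk>
        \<Longrightarrow> \<exists>g \<in> carrier G. R g x = y"
    and R_J: "\<lbrakk>g \<in> carrier G; a \<in> carrier K; a' \<in> carrier K; a \<sqsubseteq>\<^bsub>K\<^esub> a'; x \<in> fibre P p a\<rbrakk>
        \<Longrightarrow> J a' a (R g x) = R g (J a' a x)"

text \<open>The topology on the fibre \<open>F\<close> transported from the group by the orbit map of \<open>x \<in> F\<close>,
  i.e. the pullback along the inverse of that map. It does not depend on \<open>x\<close>; see
  \<open>fibre_topology_eq\<close> below.\<close>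

definition orbit_topology ::
  "('g, 'n) monoid_scheme \<Rightarrow> 'g topology \<Rightarrow> ('g \<Rightarrow> 'p \<Rightarrow> 'p) \<Rightarrow> 'p set \<Rightarrow> 'p \<Rightarrow> 'p topology" where
  "orbit_topology G TG R F x = pullback_topology F (inv_into (carrier G) (\<lambda>g. R g x)) TG"

definition fibre_topology ::
  "('g, 'n) monoid_scheme \<Rightarrow> 'g topology \<Rightarrow> ('g \<Rightarrow> 'p \<Rightarrow> 'p) \<Rightarrow> 'p set \<Rightarrow> 'p topology" where
  "fibre_topology G TG R F = orbit_topology G TG R F (SOME x. x \<in> F)"

definition cylinder ::
  "('k, 'm) gorder_scheme \<Rightarrow> ('k \<Rightarrow> 'k \<Rightarrow> 'p \<Rightarrow> 'p) \<Rightarrow> 'k \<Rightarrow> 'p set \<Rightarrow> 'p set" where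
  "cylinder K J a U = (\<Union>o' \<in> up_set K a. J o' a ` U)"

definition net_topology ::
  "('k, 'm) gorder_scheme \<Rightarrow> 'p set \<Rightarrow> ('p \<Rightarrow> 'k) \<Rightarrow> ('k \<Rightarrow> 'k \<Rightarrow> 'p \<Rightarrow> 'p) \<Rightarrow>
   ('g, 'n) monoid_scheme \<Rightarrow> 'g topology \<Rightarrow> ('g \<Rightarrow> 'p \<Rightarrow> 'p) \<Rightarrow> 'p topology" where
  "net_topology K P p J G TG R = topology (arbitrary union_of
     (\<lambda>S. \<exists>a \<in> carrier K. \<exists>U. openin (fibre_topology G TG R (fibre P p a)) U \<and>
            S = cylinder K J a U))"


section \<open>Locally trivial and locally constant bundles\<close>

definition local_trivialization ::
  "'e topology \<Rightarrow> 'b topology \<Rightarrow> 'f topology \<Rightarrow> ('e \<Rightarrow> 'b) \<Rightarrow> 'b set \<Rightarrow> ('b \<times> 'f \<Rightarrow> 'e) \<Rightarrow> bool" where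
  "local_trivialization E B F \<pi> U \<theta> \<longleftrightarrow>
     openin B U \<and>
     homeomorphic_map (prod_topology (subtopology B U) F)
       (subtopology E {z \<in> topspace E. \<pi> z \<in> U}) \<theta> \<and>
     (\<forall>b \<in> U. \<forall>f \<in> topspace F. \<pi> (\<theta> (b, f)) = b)"

definition trivializing_atlas ::
  "'e topology \<Rightarrow> 'b topology \<Rightarrow> 'f topology \<Rightarrow> ('e \<Rightarrow> 'b) \<Rightarrow> ('b set \<times> ('b \<times> 'f \<Rightarrow> 'e)) set \<Rightarrow> bool"
where
  "trivializing_atlas E B F \<pi> \<A> \<longleftrightarrow>
     (\<forall>(U, \<theta>) \<in> \<A>. local_trivialization E B F \<pi> U \<theta>) \<and> (\<Union>(U, \<theta>) \<in> \<A>. U) = topspace B"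

definition locally_trivial_bundle ::
  "'e topology \<Rightarrow> 'b topology \<Rightarrow> 'f topology \<Rightarrow> ('e \<Rightarrow> 'b) \<Rightarrow> bool" where
  "locally_trivial_bundle E B F \<pi> \<longleftrightarrow>
     continuous_map E B \<pi> \<and> (\<exists>\<A>. trivializing_atlas E B F \<pi> \<A>)"

text \<open>The transition map from the chart \<open>(U, \<theta>)\<close> to the chart \<open>(V, \<eta>)\<close> sends \<open>b \<in> U \<inter> V\<close> to the
  self-map of the typical fibre given by \<open>\<eta>\<^sup>-\<^sup>1 \<circ> \<theta>\<close> on \<open>{b} \<times> F\<close>. Restricting to \<open>topspace F\<close> makes
  equality of these self-maps mean equality on the fibre.\<close>

definition transition_map ::
  "'f topology \<Rightarrow> ('b \<times> 'f \<Rightarrow> 'e) \<Rightarrow> 'b set \<Rightarrow> ('b \<times> 'f \<Rightarrow> 'e) \<Rightarrow> 'b \<Rightarrow> ('f \<Rightarrow> 'f)" where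
  "transition_map F \<theta> V \<eta> b =
     restrict (\<lambda>f. snd (inv_into (V \<times> topspace F) \<eta> (\<theta> (b, f)))) (topspace F)"

definition locally_constant_bundle ::
  "'e topology \<Rightarrow> 'b topology \<Rightarrow> 'f topology \<Rightarrow> ('e \<Rightarrow> 'b) \<Rightarrow> bool" where
  "locally_constant_bundle E B F \<pi> \<longleftrightarrow>
     locally_trivial_bundle E B F \<pi> \<and>
     (\<exists>\<A>. trivializing_atlas E B F \<pi> \<A> \<and>
        (\<forall>(U, \<theta>) \<in> \<A>. \<forall>(V, \<eta>) \<in> \<A>.
           \<forall>C \<in> connected_components_of (subtopology B (U \<inter> V)).
             transition_map F \<theta> V \<eta> constant_on C))"


section \<open>The topologies are well defined\<close>

lemma (in partial_order) openin_alexandroff_topology: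
  "openin (alexandroff_topology L) = arbitrary union_of (\<lambda>S. \<exists>a \<in> carrier L. S = up_set L a)"
proof -
  have "(arbitrary union_of (\<lambda>S. \<exists>a \<in> carrier L. S = up_set L a)) (up_set L a \<inter> up_set L b)"
    if ab: "a \<in> carrier L" "b \<in> carrier L" for a b
  proof -
    have "up_set L a \<inter> up_set L b = \<Union>(up_set L ` (up_set L a \<inter> up_set L b))"
      using ab by (auto simp: up_set_def intro: le_trans)
    moreover have "(arbitrary union_of (\<lambda>S. \<exists>a \<in> carrier L. S = up_set L a))
        (\<Union>(up_set L ` (up_set L a \<inter> up_set L b)))"
      by (rule arbitrary_union_of_Union, rule arbitrary_union_of_inc) (auto simp: up_set_def)
    ultimately show ?thesis by simp
  qed
  then show ?thesis
    unfolding alexandroff_topology_def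
    by (subst topology_inverse') (auto simp: istopology_base_eq)
qed

context principal_net_bundle
begin

lemma orbit_bij:
  assumes "a \<in> carrier K" "x \<in> fibre P p a"
  shows "bij_betw (\<lambda>g. R g x) (carrier G) (fibre P p a)"
proof -
  have xP: "x \<in> P" using assms by (simp add: fibre_def)
  have "inj_on (\<lambda>g. R g x) (carrier G)"
  proof (rule inj_onI)
    fix g h assume gh: "g \<in> carrier G" "h \<in> carrier G" "R g x = R h x"
    then have "R (g \<otimes>\<^bsub>G\<^esub> inv\<^bsub>G\<^esub> h) x = x"
      using xP by (metis R_mult R_one inv_closed r_inv)
    then have "g \<otimes>\<^bsub>G\<^esub> inv\<^bsub>G\<^esub> h = \<one>\<^bsub>G\<^esub>"
      using R_free gh xP by auto
    then show "g = h" using gh by (metis inv_closed inv_equality inv_inv)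
  qed
  then show ?thesis
    unfolding bij_betw_def using R_fibre R_transitive assms by (auto simp: image_iff) metis
qed

lemma openin_orbit_topology:
  assumes a: "a \<in> carrier K" and x: "x \<in> fibre P p a"
  shows "openin (orbit_topology G TG R (fibre P p a) x) U \<longleftrightarrow>
         (\<exists>W. openin TG W \<and> U = (\<lambda>g. R g x) ` W)"
proof -
  have b: "bij_betw (\<lambda>g. R g x) (carrier G) (fibre P p a)" using orbit_bij[OF a x] .
  have "inv_into (carrier G) (\<lambda>g. R g x) -` W \<inter> fibre P p a = (\<lambda>g. R g x) ` W"
    if "openin TG W" for W
  proof -
    have "W \<subseteq> carrier G" using that openin_subset topspace_eq by blast
    moreover have "inv_into (carrier G) (\<lambda>g. R g x) (R g x) = g" if "g \<in> carrier G" for g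
      using bij_betw_inv_into_left[OF b that] .
    moreover have "R (inv_into (carrier G) (\<lambda>g. R g x) y) x = y" if "y \<in> fibre P p a" for y
      using bij_betw_inv_into_right[OF b that] .
    moreover have "R g x \<in> fibre P p a" if "g \<in> carrier G" for g
      using R_fibre[OF that a x] .
    ultimately show ?thesis by (auto simp: image_iff subset_iff) metis
  qed
  then show ?thesis
    unfolding orbit_topology_def openin_pullback_topology by metis
qed

lemma continuous_left_translation:
  assumes "k \<in> carrier G"
  shows "continuous_map TG TG (\<lambda>g. k \<otimes>\<^bsub>G\<^esub> g)"
proof -
  have "continuous_map TG (prod_topology TG TG) (\<lambda>g. (k, g))"
    using assms topspace_eq by (simp add: continuous_map_pairedI)
  from continuous_map_compose[OF this continuous_mult] show ?thesis by (simp add: o_def)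
qed

lemma orbit_topology_eq:
  assumes a: "a \<in> carrier K" and xy: "x \<in> fibre P p a" "y \<in> fibre P p a"
  shows "orbit_topology G TG R (fibre P p a) x = orbit_topology G TG R (fibre P p a) y"
proof -
  have *: "openin (orbit_topology G TG R (fibre P p a) y) U"
    if xy: "x \<in> fibre P p a" "y \<in> fibre P p a"
      and U: "openin (orbit_topology G TG R (fibre P p a) x) U" for x y U
  proof -
    obtain W where W: "openin TG W" "U = (\<lambda>g. R g x) ` W"
      using U openin_orbit_topology[OF a xy(1)] by blast
    obtain k where k: "k \<in> carrier G" "R k x = y" using R_transitive[OF a xy] by blast
    let ?W' = "{g \<in> carrier G. k \<otimes>\<^bsub>G\<^esub> g \<in> W}"
    have WG: "W \<subseteq> carrier G" using W openin_subset topspace_eq by blast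
    have "openin TG ?W'"
      using openin_continuous_map_preimage[OF continuous_left_translation[OF k(1)] W(1)]
      by (simp add: topspace_eq)
    moreover have "U = (\<lambda>g. R g y) ` ?W'"
    proof -
      have R: "R (k \<otimes>\<^bsub>G\<^esub> g) x = R g y" if "g \<in> carrier G" for g
        using that k xy R_mult by (auto simp: fibre_def)
      have "R w x \<in> (\<lambda>g. R g y) ` ?W'" if w: "w \<in> W" for w
      proof
        have wG: "w \<in> carrier G" using w WG by blast
        then have e: "k \<otimes>\<^bsub>G\<^esub> (inv\<^bsub>G\<^esub> k \<otimes>\<^bsub>G\<^esub> w) = w" using k by (simp flip: m_assoc)
        show "R w x = R (inv\<^bsub>G\<^esub> k \<otimes>\<^bsub>G\<^esub> w) y" using R[of "inv\<^bsub>G\<^esub> k \<otimes>\<^bsub>G\<^esub> w"] e k wG by simp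
        show "inv\<^bsub>G\<^esub> k \<otimes>\<^bsub>G\<^esub> w \<in> ?W'" using e k wG w by simp
      qed
      then show ?thesis using W(2) R by (auto simp: image_iff) metis
    qed
    ultimately show ?thesis using openin_orbit_topology[OF a xy(2)] by blast
  qed
  show ?thesis
    unfolding topology_eq using *[of x y] *[of y x] xy by blast
qed

lemma fibre_topology_eq:
  assumes "a \<in> carrier K" "x \<in> fibre P p a"
  shows "fibre_topology G TG R (fibre P p a) = orbit_topology G TG R (fibre P p a) x"
  unfolding fibre_topology_def using assms by (metis orbit_topology_eq someI)

lemma fibre_nonempty: "a \<in> carrier K \<Longrightarrow> \<exists>x. x \<in> fibre P p a"
proof -
  assume "a \<in> carrier K"
  then have "a \<in> p ` P" using surj by simp
  then show ?thesis by (auto simp: fibre_def)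
qed

lemma openin_fibre_subset:
  assumes "a \<in> carrier K" "openin (fibre_topology G TG R (fibre P p a)) U"
  shows "U \<subseteq> fibre P p a"
  using openin_subset[OF assms(2)]
  by (auto simp: fibre_topology_def orbit_topology_def topspace_pullback_topology)

lemma openin_fibre_J:
  assumes a: "a \<in> carrier K" "a' \<in> carrier K" "a \<sqsubseteq>\<^bsub>K\<^esub> a'"
    and U: "openin (fibre_topology G TG R (fibre P p a)) U"
  shows "openin (fibre_topology G TG R (fibre P p a')) (J a' a ` U)"
proof -
  obtain x where x: "x \<in> fibre P p a" using fibre_nonempty a(1) by blast
  have x': "J a' a x \<in> fibre P p a'" using J_bij[OF a] x by (auto simp: bij_betw_def)
  obtain W where W: "openin TG W" "U = (\<lambda>g. R g x) ` W"
    using U openin_orbit_topology[OF a(1) x] fibre_topology_eq[OF a(1) x] by auto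
  have "W \<subseteq> carrier G" using W openin_subset topspace_eq by blast
  then have "J a' a ` U = (\<lambda>g. R g (J a' a x)) ` W"
    using R_J[OF _ a x] by (auto simp: W(2) image_image intro!: image_cong)
  then show ?thesis
    using W openin_orbit_topology[OF a(2) x'] fibre_topology_eq[OF a(2) x'] by auto
qed

lemma openin_net_topology:
  "openin (net_topology K P p J G TG R) = arbitrary union_of
     (\<lambda>S. \<exists>a \<in> carrier K. \<exists>U. openin (fibre_topology G TG R (fibre P p a)) U \<and>
            S = cylinder K J a U)"
proof -
  let ?B = "\<lambda>S. \<exists>a \<in> carrier K. \<exists>U. openin (fibre_topology G TG R (fibre P p a)) U \<and>
            S = cylinder K J a U"
  have "(arbitrary union_of ?B) (cylinder K J a U \<inter> cylinder K J b V)"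
    if a: "a \<in> carrier K" and U: "openin (fibre_topology G TG R (fibre P p a)) U"
      and b: "b \<in> carrier K" and V: "openin (fibre_topology G TG R (fibre P p b)) V" for a U b V
  proof -
    let ?I = "up_set K a \<inter> up_set K b"
    let ?W = "\<lambda>c. J c a ` U \<inter> J c b ` V"
    have Ua: "U \<subseteq> fibre P p a" and Vb: "V \<subseteq> fibre P p b"
      using openin_fibre_subset a b U V by blast+
    have opn: "openin (fibre_topology G TG R (fibre P p c)) (?W c)" if "c \<in> ?I" for c
      using that openin_fibre_J a b U V by (auto simp: up_set_def)
    have Jf: "p (J d c x) = d" if "x \<in> fibre P p c" "c \<in> carrier K" "d \<in> up_set K c" for c d x
      using J_bij[of c d] that by (auto simp: bij_betw_def up_set_def fibre_def)
    have "z \<in> (\<Union>c\<in>?I. cylinder K J c (?W c))"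
      if z: "z \<in> cylinder K J a U" "z \<in> cylinder K J b V" for z
    proof -
      obtain c x where c: "c \<in> up_set K a" "x \<in> U" "z = J c a x"
        using z by (auto simp: cylinder_def)
      obtain d y where d: "d \<in> up_set K b" "y \<in> V" "z = J d b y"
        using z by (auto simp: cylinder_def)
      have "c = d" using Jf[of x a c] Jf[of y b d] c d subsetD[OF Ua c(2)] subsetD[OF Vb d(2)] a b by simp
      then have zW: "z \<in> ?W c" and cI: "c \<in> ?I" using c d by blast+
      have cK: "c \<in> carrier K" using cI by (simp add: up_set_def)
      have "z \<in> fibre P p c" using openin_fibre_subset[OF cK opn[OF cI]] zW by blast
      then have "z = J c c z" using J_id cK by simp
      then have "z \<in> cylinder K J c (?W c)"
        using zW cK unfolding cylinder_def up_set_def by blast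
      then show ?thesis using cI by blast
    qed
    moreover have "J d c z \<in> cylinder K J a U \<inter> cylinder K J b V"
      if c: "c \<in> ?I" and d: "d \<in> up_set K c" and z: "z \<in> ?W c" for c d z
    proof -
      have m: "c \<in> carrier K" "d \<in> carrier K" "a \<sqsubseteq>\<^bsub>K\<^esub> c" "b \<sqsubseteq>\<^bsub>K\<^esub> c" "c \<sqsubseteq>\<^bsub>K\<^esub> d"
        using c d by (auto simp: up_set_def)
      have dI: "d \<in> up_set K a" "d \<in> up_set K b"
        using m a b le_trans by (auto simp: up_set_def)
      obtain x y where x: "x \<in> U" "z = J c a x" and y: "y \<in> V" "z = J c b y" using z by blast
      have "J d c z = J d a x" "J d c z = J d b y"
        using J_comp[of a c d x] J_comp[of b c d y] m x y a b Ua Vb by auto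
      then show ?thesis using dI x y unfolding cylinder_def by blast
    qed
    then have "w \<in> cylinder K J a U \<inter> cylinder K J b V"
      if "c \<in> ?I" "w \<in> cylinder K J c (?W c)" for c w
      using that unfolding cylinder_def[of K J c] by blast
    ultimately have "cylinder K J a U \<inter> cylinder K J b V = \<Union>((\<lambda>c. cylinder K J c (?W c)) ` ?I)"
      by blast
    moreover have "\<forall>c\<in>?I. ?B (cylinder K J c (?W c))"
      using opn by (auto simp: up_set_def)
    then have "(arbitrary union_of ?B) (\<Union>((\<lambda>c. cylinder K J c (?W c)) ` ?I))"
      by (intro arbitrary_union_of_Union arbitrary_union_of_inc) blast
    ultimately show ?thesis by simp
  qed
  then show ?thesis
    unfolding net_topology_def by (subst topology_inverse') (auto simp: istopology_base_eq)
qed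

end

end

theory Submission
  imports Defs
begin

text \<open>Choosing \<open>x\<close> in the fibre over \<open>a\<close> gives a trivialization \<open>(o, g) \<mapsto> R\<^sub>g (J\<^bsub>(o,a)\<^esub> x)\<close> over the
  basic open set \<open>V\<^sub>a\<close>. Two such trivializations, from \<open>x\<close> over \<open>a\<close> and \<open>y\<close> over \<open>b\<close>, differ at
  \<open>o\<close> by the left translation by the \<open>k\<close> with \<open>R\<^sub>k (J\<^bsub>(o,b)\<^esub> y) = J\<^bsub>(o,a)\<^esub> x\<close>. Applying \<open>J\<^bsub>(o',o)\<^esub>\<close> to
  this equation shows that the same \<open>k\<close> works at every \<open>o'\<close> above \<open>o\<close>, and a function that takes equal
  values at comparable points is locally constant in the Alexandroff topology.\<close>

section \<open>Open sets of the Alexandroff topology and locally constant functions\<close>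

lemma (in partial_order) openin_alexandroff_iff:
  "openin (alexandroff_topology L) S \<longleftrightarrow> S \<subseteq> carrier L \<and> (\<forall>a \<in> S. up_set L a \<subseteq> S)"
proof
  assume "openin (alexandroff_topology L) S"
  then obtain \<U> where "\<U> \<subseteq> {S. \<exists>a \<in> carrier L. S = up_set L a}" "S = \<Union>\<U>"
    unfolding openin_alexandroff_topology union_of_def arbitrary_def by auto
  then show "S \<subseteq> carrier L \<and> (\<forall>a \<in> S. up_set L a \<subseteq> S)"
    by (fastforce simp: up_set_def intro: le_trans)
next
  assume S: "S \<subseteq> carrier L \<and> (\<forall>a \<in> S. up_set L a \<subseteq> S)"
  moreover from this have "a \<in> up_set L a" if "a \<in> S" for a
    using that by (auto simp: up_set_def)
  ultimately have "S = \<Union>(up_set L ` S)"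
    by blast
  moreover have "openin (alexandroff_topology L) (\<Union>(up_set L ` S))"
    unfolding openin_alexandroff_topology
    by (rule arbitrary_union_of_Union, rule arbitrary_union_of_inc) (use S in auto)
  ultimately show "openin (alexandroff_topology L) S"
    by simp
qed

lemma (in partial_order) openin_up_set:
  "a \<in> carrier L \<Longrightarrow> openin (alexandroff_topology L) (up_set L a)"
  by (auto simp: openin_alexandroff_iff up_set_def intro: le_trans)

lemma (in partial_order) topspace_alexandroff [simp]:
  "topspace (alexandroff_topology L) = carrier L"
proof
  show "topspace (alexandroff_topology L) \<subseteq> carrier L"
    using openin_topspace openin_alexandroff_iff by blast
  have "openin (alexandroff_topology L) (carrier L)"
    by (auto simp: openin_alexandroff_iff up_set_def)
  then show "carrier L \<subseteq> topspace (alexandroff_topology L)"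
    by (rule openin_subset)
qed

text \<open>A function that does not change on going up inside \<open>S\<close> has upper sets as
  preimages of arbitrary sets. These are open, so the function is continuous into a discrete space,
  where a connected set has at most one point.\<close>

lemma (in partial_order) constant_on_connected_component:
  assumes S: "openin (alexandroff_topology L) S"
    and f: "\<And>a b. \<lbrakk>a \<in> S; b \<in> up_set L a\<rbrakk> \<Longrightarrow> f b = f a"
    and C: "C \<in> connected_components_of (subtopology (alexandroff_topology L) S)"
  shows "f constant_on C"
proof -
  let ?X = "subtopology (alexandroff_topology L) S"
  have "openin (alexandroff_topology L) {a \<in> S. f a \<in> U}" for U
    using S f by (auto simp: openin_alexandroff_iff)
  then have "continuous_map ?X (discrete_topology UNIV) f"
    using S openin_subset[OF S]
    by (simp add: continuous_map_def openin_open_subtopology Int_absorb1)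
  moreover have "connectedin ?X C"
    using C by (rule connectedin_connected_components_of)
  ultimately have "connectedin (discrete_topology UNIV) (f ` C)"
    by (rule connectedin_continuous_map_image)
  then obtain y where "f ` C \<subseteq> {y}"
    by (auto simp: connectedin_discrete_topology)
  then show ?thesis
    unfolding constant_on_def by (intro exI[of _ y]) auto
qed

section \<open>Open sets of the net topology and continuity of \<open>p\<close>\<close>

context principal_net_bundle
begin

lemma openin_fibre_iff:
  assumes "a \<in> carrier K" "x \<in> fibre P p a"
  shows "openin (fibre_topology G TG R (fibre P p a)) U \<longleftrightarrow>
    (\<exists>W. openin TG W \<and> U = (\<lambda>g. R g x) ` W)"
  using assms by (simp add: fibre_topology_eq openin_orbit_topology)

lemma openin_fibre_topspace:
  assumes "a \<in> carrier K"
  shows "openin (fibre_topology G TG R (fibre P p a)) (fibre P p a)"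
proof -
  obtain x where x: "x \<in> fibre P p a"
    using fibre_nonempty assms by blast
  have "fibre P p a = (\<lambda>g. R g x) ` carrier G"
    using orbit_bij[OF assms x] by (simp add: bij_betw_def)
  then show ?thesis
    using openin_fibre_iff[OF assms x] openin_topspace topspace_eq by metis
qed

lemma J_fibre:
  assumes "a \<in> carrier K" "c \<in> up_set K a" "x \<in> fibre P p a"
  shows "J c a x \<in> fibre P p c"
  using J_bij[of a c] assms by (auto simp: bij_betw_def up_set_def)

lemma J_trans:
  assumes "a \<in> carrier K" "c \<in> up_set K a" "d \<in> up_set K c" "x \<in> fibre P p a"
  shows "J d c (J c a x) = J d a x"
  using J_comp assms by (simp add: up_set_def)

lemma up_set_trans:
  "\<lbrakk>a \<in> carrier K; c \<in> up_set K a; d \<in> up_set K c\<rbrakk> \<Longrightarrow> d \<in> up_set K a"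
  by (auto simp: up_set_def intro: le_trans)

lemma fibre_p: "x \<in> P \<Longrightarrow> p x \<in> carrier K \<and> x \<in> fibre P p (p x)"
  using surj by (auto simp: fibre_def)

text \<open>This replaces the base of cylinders by conditions on single fibres and on transport, the
  analogue of upper sets for the total space. Cylinders satisfy the three conditions, and the
  conditions pass to unions. Conversely, a set that satisfies them is the union of the cylinders
  over its own fibre slices.\<close>

lemma openin_net_iff:
  "openin (net_topology K P p J G TG R) S \<longleftrightarrow>
     S \<subseteq> P \<and>
     (\<forall>a \<in> carrier K. openin (fibre_topology G TG R (fibre P p a)) (S \<inter> fibre P p a)) \<and>
     (\<forall>x \<in> S. \<forall>c \<in> up_set K (p x). J c (p x) x \<in> S)"
    (is "_ \<longleftrightarrow> ?open S")
proof
  have cyl: "?open (cylinder K J a U)"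
    if a: "a \<in> carrier K" and U: "openin (fibre_topology G TG R (fibre P p a)) U" for a U
  proof (intro conjI ballI)
    have Ua: "U \<subseteq> fibre P p a"
      using openin_fibre_subset[OF a U] .
    have fib: "J c a u \<in> fibre P p c" if "c \<in> up_set K a" "u \<in> U" for c u
      using J_fibre[OF a that(1)] that(2) Ua by blast
    show "cylinder K J a U \<subseteq> P"
      using fib by (auto simp: cylinder_def fibre_def)
    show "openin (fibre_topology G TG R (fibre P p c)) (cylinder K J a U \<inter> fibre P p c)"
      if c: "c \<in> carrier K" for c
    proof (cases "c \<in> up_set K a")
      case True
      \<comment> \<open>Each \<open>J d a u\<close> lies over \<open>d\<close>, so only the index
        \<open>d = c\<close> of the union contributes.\<close>
      have "cylinder K J a U \<inter> fibre P p c = J c a ` U"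
        using True fib by (fastforce simp: cylinder_def fibre_def)
      then show ?thesis
        using openin_fibre_J[OF a c _ U] True by (simp add: up_set_def)
    next
      case False
      then have "cylinder K J a U \<inter> fibre P p c = {}"
        using fib by (fastforce simp: cylinder_def fibre_def)
      then show ?thesis
        by simp
    qed
    fix x c
    assume "x \<in> cylinder K J a U" and c: "c \<in> up_set K (p x)"
    then obtain d u where d: "d \<in> up_set K a" "u \<in> U" "x = J d a u"
      by (auto simp: cylinder_def)
    then have "p x = d"
      using fib by (auto simp: fibre_def)
    then have "J c (p x) x = J c a u" "c \<in> up_set K a"
      using J_trans[OF a d(1), of c u] up_set_trans[OF a d(1)] c d Ua by auto
    then show "J c (p x) x \<in> cylinder K J a U"
      using d(2) by (auto simp: cylinder_def)
  qed
  assume "openin (net_topology K P p J G TG R) S"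
  then obtain \<U> where \<U>: "\<And>T. T \<in> \<U> \<Longrightarrow> ?open T" and S: "S = \<Union>\<U>"
    unfolding openin_net_topology union_of_def arbitrary_def using cyl
    by (smt (verit) mem_Collect_eq subset_iff)
  have "openin (fibre_topology G TG R (fibre P p a)) (\<Union>T\<in>\<U>. T \<inter> fibre P p a)"
    if "a \<in> carrier K" for a
    using that \<U> by (intro openin_Union) blast
  moreover have "S \<inter> fibre P p a = (\<Union>T\<in>\<U>. T \<inter> fibre P p a)" for a
    using S by blast
  moreover have "S \<subseteq> P" "\<forall>x \<in> S. \<forall>c \<in> up_set K (p x). J c (p x) x \<in> S"
    using \<U> S by blast+
  ultimately show "?open S"
    by simp
next
  assume S: "?open S"
  \<comment> \<open>A point lies in the cylinder based at its own base point, because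
    \<open>J (p x) (p x)\<close> fixes it. The cylinders stay inside \<open>S\<close> because
    \<open>S\<close> is stable under transport.\<close>
  have "S = (\<Union>a \<in> carrier K. cylinder K J a (S \<inter> fibre P p a))"
  proof (intro equalityI subsetI)
    fix x
    assume x: "x \<in> S"
    then have "p x \<in> carrier K" "x \<in> fibre P p (p x)"
      using S fibre_p by blast+
    moreover from this have "x = J (p x) (p x) x" "p x \<in> up_set K (p x)"
      using J_id by (auto simp: up_set_def)
    ultimately show "x \<in> (\<Union>a \<in> carrier K. cylinder K J a (S \<inter> fibre P p a))"
      using x unfolding cylinder_def by blast
  next
    fix x
    assume "x \<in> (\<Union>a \<in> carrier K. cylinder K J a (S \<inter> fibre P p a))"
    then show "x \<in> S"
      using S by (auto simp: cylinder_def fibre_def)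
  qed
  moreover have "openin (net_topology K P p J G TG R)
      (\<Union>a \<in> carrier K. cylinder K J a (S \<inter> fibre P p a))"
    unfolding openin_net_topology
    by (rule arbitrary_union_of_Union, rule arbitrary_union_of_inc) (use S in blast)
  ultimately show "openin (net_topology K P p J G TG R) S"
    by simp
qed

text \<open>Over each base point this set contains the whole fibre or nothing, and it is stable
  under transport because \<open>S\<close> is an upper set. Besides continuity of \<open>p\<close>,
  it yields that the part of \<open>P\<close> over \<open>up_set K a\<close> is open.\<close>

lemma openin_net_vimage:
  assumes S: "openin (alexandroff_topology K) S"
  shows "openin (net_topology K P p J G TG R) {z \<in> P. p z \<in> S}"
  unfolding openin_net_iff
proof (intro conjI ballI)
  show "openin (fibre_topology G TG R (fibre P p a)) ({z \<in> P. p z \<in> S} \<inter> fibre P p a)"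
    if "a \<in> carrier K" for a
  proof -
    have "{z \<in> P. p z \<in> S} \<inter> fibre P p a = (if a \<in> S then fibre P p a else {})"
      by (auto simp: fibre_def)
    then show ?thesis
      using openin_fibre_topspace[OF that] by simp
  qed
  fix x c
  assume x: "x \<in> {z \<in> P. p z \<in> S}" and c: "c \<in> up_set K (p x)"
  then have "J c (p x) x \<in> fibre P p c"
    using fibre_p J_fibre by blast
  then show "J c (p x) x \<in> {z \<in> P. p z \<in> S}"
    using x c S by (auto simp: fibre_def openin_alexandroff_iff)
qed auto

lemma topspace_net [simp]: "topspace (net_topology K P p J G TG R) = P"
proof
  show "topspace (net_topology K P p J G TG R) \<subseteq> P"
    using openin_topspace openin_net_iff by blast
  have "{z \<in> P. p z \<in> carrier K} = P"
    using surj by blast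
  then show "P \<subseteq> topspace (net_topology K P p J G TG R)"
    using openin_net_vimage[OF openin_topspace] openin_subset by fastforce
qed

lemma continuous_map_p:
  "continuous_map (net_topology K P p J G TG R) (alexandroff_topology K) p"
  unfolding continuous_map_def using openin_net_vimage surj by auto

section \<open>Charts over \<open>up_set K a\<close>, built on the flat section through a point
  \<open>x\<close> of the fibre over \<open>a\<close>\<close>

definition chart :: "'k \<Rightarrow> 'p \<Rightarrow> 'k \<times> 'g \<Rightarrow> 'p" where
  "chart a x = (\<lambda>(c, g). R g (J c a x))"

context
  fixes a x
  assumes a: "a \<in> carrier K" and x: "x \<in> fibre P p a"
begin

lemma chart_fibre:
  assumes "c \<in> up_set K a" "g \<in> carrier G"
  shows "chart a x (c, g) \<in> fibre P p c"
  using assms J_fibre[OF a _ x] R_fibre by (auto simp: chart_def up_set_def)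

text \<open>Since \<open>J\<close> commutes with \<open>R\<close>, transport in chart coordinates
  moves only the base coordinate and keeps the group coordinate. This is what matches boxes
  \<open>up_set K c \<times> W\<close> with cylinders.\<close>

lemma J_chart:
  assumes "c \<in> up_set K a" "d \<in> up_set K c" "g \<in> carrier G"
  shows "J d c (chart a x (c, g)) = chart a x (d, g)"
  using assms J_fibre[OF a _ x] R_J[of g c d] J_trans[OF a _ _ x]
  by (auto simp: chart_def up_set_def)

text \<open>The fibre topology does not depend on the point whose orbit map is used, so
  \<open>J c a x\<close> may be taken as that point over \<open>c\<close>.\<close>

lemma openin_fibre_chart:
  assumes "c \<in> up_set K a"
  shows "openin (fibre_topology G TG R (fibre P p c)) U \<longleftrightarrow>
    (\<exists>W. openin TG W \<and> U = (\<lambda>g. chart a x (c, g)) ` W)"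
  using assms openin_fibre_iff[OF _ J_fibre[OF a _ x]] by (simp add: chart_def up_set_def)

lemma bij_betw_chart_fibre:
  assumes "c \<in> up_set K a"
  shows "bij_betw (\<lambda>g. chart a x (c, g)) (carrier G) (fibre P p c)"
  using assms orbit_bij[OF _ J_fibre[OF a _ x]] by (simp add: chart_def up_set_def)

lemma inj_on_chart: "inj_on (chart a x) (up_set K a \<times> carrier G)"
proof (rule inj_onI, clarify)
  fix c g d h
  assume *: "c \<in> up_set K a" "g \<in> carrier G" "d \<in> up_set K a" "h \<in> carrier G"
    "chart a x (c, g) = chart a x (d, h)"
  then have "c = d"
    using chart_fibre[of c g] chart_fibre[of d h] by (simp add: fibre_def)
  moreover from this have "g = h"
    using * bij_betw_chart_fibre[of c] by (auto simp: bij_betw_def dest: inj_onD)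
  ultimately show "c = d \<and> g = h" ..
qed

lemma image_chart: "chart a x ` (up_set K a \<times> carrier G) = {z \<in> P. p z \<in> up_set K a}"
proof (intro equalityI subsetI)
  fix z
  assume "z \<in> chart a x ` (up_set K a \<times> carrier G)"
  then show "z \<in> {z \<in> P. p z \<in> up_set K a}"
    using chart_fibre by (auto simp: fibre_def)
next
  fix z
  assume "z \<in> {z \<in> P. p z \<in> up_set K a}"
  then have "p z \<in> up_set K a" "z \<in> fibre P p (p z)"
    by (auto simp: fibre_def)
  then obtain g where "g \<in> carrier G" "z = chart a x (p z, g)"
    using bij_betw_chart_fibre[of "p z"] by (auto simp: bij_betw_def)
  then show "z \<in> chart a x ` (up_set K a \<times> carrier G)"
    using \<open>p z \<in> up_set K a\<close> by blast
qed

text \<open>On both sides, openness amounts to openness over each base point together with stability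
  under going up. The chart matches the two conditions by \<open>openin_fibre_chart\<close> and
  \<open>J_chart\<close>.\<close>

lemma homeomorphic_map_chart:
  "homeomorphic_map (prod_topology (subtopology (alexandroff_topology K) (up_set K a)) TG)
     (subtopology (net_topology K P p J G TG R) {z \<in> P. p z \<in> up_set K a}) (chart a x)"
    (is "homeomorphic_map ?X ?Y _")
proof (rule bijective_open_imp_homeomorphic_map)
  have V: "openin (alexandroff_topology K) (up_set K a)"
    using openin_up_set[OF a] .
  have VK: "up_set K a \<subseteq> carrier K"
    by (auto simp: up_set_def)
  have X: "topspace ?X = up_set K a \<times> carrier G"
    using VK by (auto simp: topspace_eq)
  show "inj_on (chart a x) (topspace ?X)"
    using inj_on_chart X by simp
  show "chart a x ` topspace ?X = topspace ?Y"
    unfolding X image_chart by auto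
  show "continuous_map ?X ?Y (chart a x)"
  proof (rule continuous_map_into_subtopology)
    show "chart a x \<in> topspace ?X \<rightarrow> {z \<in> P. p z \<in> up_set K a}"
      unfolding X using image_chart by blast
    have "openin ?X {q \<in> topspace ?X. chart a x q \<in> S}"
      if S: "openin (net_topology K P p J G TG R) S" for S
      unfolding openin_prod_topology_alt
    proof (intro allI impI)
      fix c g
      assume "(c, g) \<in> {q \<in> topspace ?X. chart a x q \<in> S}"
      then have c: "c \<in> up_set K a" and g: "g \<in> carrier G" and cg: "chart a x (c, g) \<in> S"
        using X by auto
      then have cK: "c \<in> carrier K"
        using VK by blast
      have "openin (fibre_topology G TG R (fibre P p c)) (S \<inter> fibre P p c)"
        using S cK by (auto simp: openin_net_iff)
      \<comment> \<open>\<open>W\<close> collects the group coordinates of the slice of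
        \<open>S\<close> over \<open>c\<close>. With the least neighbourhood
        \<open>up_set K c\<close> of \<open>c\<close> it forms the required box around
        \<open>(c, g)\<close>.\<close>
      then obtain W where W: "openin TG W" "S \<inter> fibre P p c = (\<lambda>g. chart a x (c, g)) ` W"
        using openin_fibre_chart[OF c] by blast
      have WG: "W \<subseteq> carrier G"
        using openin_subset[OF W(1)] topspace_eq by simp
      have "chart a x (c, g) \<in> (\<lambda>g. chart a x (c, g)) ` W"
        using W(2) cg chart_fibre[OF c g] by blast
      then have "g \<in> W"
        using inj_on_image_mem_iff[OF _ g WG] bij_betw_chart_fibre[OF c]
        by (auto simp: bij_betw_def)
      moreover have "openin (subtopology (alexandroff_topology K) (up_set K a)) (up_set K c)"
        using openin_up_set[OF cK] up_set_trans[OF a c]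
        by (auto simp: openin_open_subtopology[OF V])
      moreover have "c \<in> up_set K c"
        using cK by (simp add: up_set_def)
      \<comment> \<open>A point of the box is reached by transport from the slice over
        \<open>c\<close>, with \<open>h\<close> unchanged, and \<open>S\<close> is stable under
        transport.\<close>
      moreover have "up_set K c \<times> W \<subseteq> {q \<in> topspace ?X. chart a x q \<in> S}"
      proof clarify
        fix d h
        assume d: "d \<in> up_set K c" and h: "h \<in> W"
        have "chart a x (c, h) \<in> S" "p (chart a x (c, h)) = c"
          using W(2) h by (auto simp: fibre_def)
        then have "J d c (chart a x (c, h)) \<in> S"
          using S d by (auto simp: openin_net_iff)
        then have "chart a x (d, h) \<in> S"
          using J_chart[OF c d] h WG by auto
        then show "(d, h) \<in> topspace ?X \<and> chart a x (d, h) \<in> S"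
          using X h WG up_set_trans[OF a c d] by auto
      qed
      ultimately show "\<exists>U V. openin (subtopology (alexandroff_topology K) (up_set K a)) U \<and>
          openin TG V \<and> c \<in> U \<and> g \<in> V \<and> U \<times> V \<subseteq> {q \<in> topspace ?X. chart a x q \<in> S}"
        using W(1) by blast
    qed
    moreover have "chart a x \<in> topspace ?X \<rightarrow> P"
      unfolding X using image_chart by blast
    ultimately show "continuous_map ?X (net_topology K P p J G TG R) (chart a x)"
      by (simp add: continuous_map_def)
  qed
  show "open_map ?X ?Y (chart a x)"
    unfolding open_map_def
  proof (intro allI impI)
    fix T
    assume T: "openin ?X T"
    have TX: "T \<subseteq> up_set K a \<times> carrier G"
      using openin_subset[OF T] X by simp
    \<comment> \<open>Every open set of the base that contains \<open>c\<close> contains all of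
      \<open>up_set K c\<close>, so \<open>T\<close> is stable under raising the base
      coordinate.\<close>
    have up: "(d, g) \<in> T" if cg: "(c, g) \<in> T" and d: "d \<in> up_set K c" for c d g
    proof -
      obtain U W where U: "openin (subtopology (alexandroff_topology K) (up_set K a)) U"
        and "c \<in> U" "g \<in> W" "U \<times> W \<subseteq> T"
        using T cg unfolding openin_prod_topology_alt by blast
      moreover have "up_set K c \<subseteq> U"
        using U \<open>c \<in> U\<close> by (auto simp: openin_open_subtopology[OF V] openin_alexandroff_iff)
      ultimately show ?thesis
        using d by blast
    qed
    have "openin (net_topology K P p J G TG R) (chart a x ` T)"
      unfolding openin_net_iff
    proof (intro conjI ballI)
      show "chart a x ` T \<subseteq> P"
        using TX image_chart by blast
      show "openin (fibre_topology G TG R (fibre P p c)) (chart a x ` T \<inter> fibre P p c)"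
        if "c \<in> carrier K" for c
      proof (cases "c \<in> up_set K a")
        case True
        \<comment> \<open>The group coordinates of \<open>T\<close> over \<open>c\<close> form the
          preimage of \<open>T\<close> under this map, hence an open set.\<close>
        have "continuous_map TG ?X (\<lambda>g. (c, g))"
          using True VK by (intro continuous_map_pairedI) auto
        then have "openin TG {g \<in> carrier G. (c, g) \<in> T}"
          using openin_continuous_map_preimage[OF _ T] by (fastforce simp: topspace_eq)
        moreover have "chart a x ` T \<inter> fibre P p c =
            (\<lambda>g. chart a x (c, g)) ` {g \<in> carrier G. (c, g) \<in> T}"
        proof -
          have "c = d" if "(d, g) \<in> T" "chart a x (d, g) \<in> fibre P p c" for d g
            using that TX chart_fibre[of d g] by (auto simp: fibre_def)
          then show ?thesis
            using TX chart_fibre[OF True] by auto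
        qed
        ultimately show ?thesis
          using openin_fibre_chart[OF True] by blast
      next
        case False
        then have "chart a x ` T \<inter> fibre P p c = {}"
          using TX image_chart by (auto simp: fibre_def)
        then show ?thesis
          by simp
      qed
      fix z d
      assume "z \<in> chart a x ` T" and d: "d \<in> up_set K (p z)"
      then obtain c g where cg: "(c, g) \<in> T" "z = chart a x (c, g)"
        by auto
      then have "c \<in> up_set K a" "g \<in> carrier G"
        using TX by auto
      moreover from this have "p z = c"
        using chart_fibre cg(2) by (simp add: fibre_def)
      ultimately have "J d (p z) z = chart a x (d, g)" "(d, g) \<in> T"
        using J_chart up cg d by auto
      then show "J d (p z) z \<in> chart a x ` T"
        by simp
    qed
    moreover have "chart a x ` T \<subseteq> {z \<in> P. p z \<in> up_set K a}"
      using TX image_chart by blast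
    \<comment> \<open>The subspace is itself open in the net topology, so openness there is openness
      in \<open>P\<close>.\<close>
    ultimately show "openin ?Y (chart a x ` T)"
      by (simp add: openin_open_subtopology openin_net_vimage V)
  qed
qed

lemma local_trivialization_chart:
  "local_trivialization (net_topology K P p J G TG R) (alexandroff_topology K) TG p
     (up_set K a) (chart a x)"
  unfolding local_trivialization_def
  using openin_up_set[OF a] homeomorphic_map_chart chart_fibre
  by (simp add: topspace_eq fibre_def)

section \<open>Transition maps as left translations\<close>

lemma transition_map_chart:
  assumes b: "b \<in> carrier K" and y: "y \<in> fibre P p b"
    and c: "c \<in> up_set K a" "c \<in> up_set K b"
    and k: "k \<in> carrier G" "R k (J c a x) = J c b y"
  shows "transition_map TG (chart b y) (up_set K a) (chart a x) c =
    restrict (\<lambda>g. k \<otimes>\<^bsub>G\<^esub> g) (carrier G)"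
  unfolding transition_map_def topspace_eq
proof (rule restrict_ext)
  fix g
  assume g: "g \<in> carrier G"
  have "J c a x \<in> P"
    using J_fibre[OF a c(1) x] by (simp add: fibre_def)
  \<comment> \<open>For a right action, applying \<open>R k\<close> and then \<open>R g\<close> is
    applying \<open>R\<close> of \<open>k \<otimes> g\<close>; hence the change of base point from
    \<open>J c b y\<close> to \<open>J c a x\<close> multiplies on the left.\<close>
  then have "chart b y (c, g) = chart a x (c, k \<otimes>\<^bsub>G\<^esub> g)"
    using k g by (simp add: chart_def R_mult)
  then show "snd (inv_into (up_set K a \<times> carrier G) (chart a x) (chart b y (c, g))) = k \<otimes>\<^bsub>G\<^esub> g"
    using inv_into_f_f[OF inj_on_chart, of "(c, k \<otimes>\<^bsub>G\<^esub> g)"] c(1) k(1) g by simp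
qed

text \<open>The translating element \<open>k\<close> found at \<open>c\<close> also serves at
  \<open>d\<close>, because \<open>J d c\<close> carries its defining equation from \<open>c\<close>
  to \<open>d\<close>. This supplies the hypothesis of
  \<open>constant_on_connected_component\<close> for transition maps.\<close>

lemma transition_map_chart_up:
  assumes b: "b \<in> carrier K" and y: "y \<in> fibre P p b"
    and c: "c \<in> up_set K a" "c \<in> up_set K b" and d: "d \<in> up_set K c"
  shows "transition_map TG (chart b y) (up_set K a) (chart a x) d =
    transition_map TG (chart b y) (up_set K a) (chart a x) c"
proof -
  have cK: "c \<in> carrier K"
    using c by (simp add: up_set_def)
  obtain k where k: "k \<in> carrier G" "R k (J c a x) = J c b y"
    using R_transitive[OF cK J_fibre[OF a c(1) x] J_fibre[OF b c(2) y]] by blast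
  have "R k (J d a x) = J d c (R k (J c a x))"
    using R_J[OF k(1) cK, of d "J c a x"] J_fibre[OF a c(1) x] J_trans[OF a c(1) d x] d
    by (simp add: up_set_def)
  also have "\<dots> = J d b y"
    using k J_trans[OF b c(2) d y] by simp
  finally show ?thesis
    using transition_map_chart[OF b y] k c up_set_trans[OF a c(1) d] up_set_trans[OF b c(2) d]
    by simp
qed

end

text \<open>The atlas takes the charts for all \<open>a\<close> and all \<open>x\<close> over
  \<open>a\<close>. It covers the base because fibres are nonempty and \<open>a\<close> lies in
  \<open>up_set K a\<close>. The same atlas witnesses local triviality and local constancy.\<close>

lemma locally_constant_net_bundle:
  "locally_constant_bundle (net_topology K P p J G TG R) (alexandroff_topology K) TG p"
proof -
  let ?E = "net_topology K P p J G TG R" and ?B = "alexandroff_topology K"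
  define \<A> where "\<A> = {(up_set K a, chart a x) | a x. a \<in> carrier K \<and> x \<in> fibre P p a}"
  have "(\<Union>(U, \<theta>) \<in> \<A>. U) = carrier K"
  proof
    show "(\<Union>(U, \<theta>) \<in> \<A>. U) \<subseteq> carrier K"
      by (auto simp: \<A>_def up_set_def)
    show "carrier K \<subseteq> (\<Union>(U, \<theta>) \<in> \<A>. U)"
    proof
      fix a
      assume a: "a \<in> carrier K"
      then obtain x where "x \<in> fibre P p a"
        using fibre_nonempty by blast
      then have "(up_set K a, chart a x) \<in> \<A>"
        using a by (auto simp: \<A>_def)
      moreover have "a \<in> up_set K a"
        using a by (simp add: up_set_def)
      ultimately show "a \<in> (\<Union>(U, \<theta>) \<in> \<A>. U)"
        by blast
    qed
  qed
  moreover have "\<forall>(U, \<theta>) \<in> \<A>. local_trivialization ?E ?B TG p U \<theta>"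
    using local_trivialization_chart by (auto simp: \<A>_def)
  ultimately have atlas: "trivializing_atlas ?E ?B TG p \<A>"
    by (simp add: trivializing_atlas_def)
  have "transition_map TG (chart b y) (up_set K a) (chart a x) constant_on C"
    if "a \<in> carrier K" "x \<in> fibre P p a" "b \<in> carrier K" "y \<in> fibre P p b"
      and "C \<in> connected_components_of (subtopology ?B (up_set K b \<inter> up_set K a))"
    for a x b y C
    using that
    by (intro constant_on_connected_component[OF _ _ that(5)] openin_Int openin_up_set
        transition_map_chart_up) auto
  then have "\<forall>(U, \<theta>) \<in> \<A>. \<forall>(V, \<eta>) \<in> \<A>. \<forall>C \<in> connected_components_of (subtopology ?B (U \<inter> V)).
      transition_map TG \<theta> V \<eta> constant_on C"
    by (auto simp: \<A>_def)
  then show ?thesis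
    unfolding locally_constant_bundle_def locally_trivial_bundle_def
    using atlas continuous_map_p by blast
qed

end

theorem corollary4p9:
  fixes K :: "('k, 'm) gorder_scheme"
    and G :: "('g, 'n) monoid_scheme"
    and TG :: "'g topology"
    and P :: "'p set"
    and p :: "'p \<Rightarrow> 'k"
    and J :: "'k \<Rightarrow> 'k \<Rightarrow> 'p \<Rightarrow> 'p"
    and R :: "'g \<Rightarrow> 'p \<Rightarrow> 'p"
  assumes "partial_order K"
    and "pathwise_connected_poset K"
    and "topological_group G TG"
    and "principal_net_bundle K P p J G TG R"
  shows "locally_constant_bundle (net_topology K P p J G TG R) (alexandroff_topology K) TG p"
  using assms(4) by (rule principal_net_bundle.locally_constant_net_bundle)

end
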